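(* For every $k\ge 1$ there is a set $\mathcal{Q}_k\subseteq\mathcal{S}_k$ with $|\mathcal{Q}_k|=(1-o(1))k!$ (as $k\to\infty$) such that, if $\sigma$ is a uniformly random permutation of length $n=20k^2$, then with probability $1-o(1)$ as $k\to\infty$, $\sigma$ contains every $\pi\in\mathcal{Q}_k$.
   Context: $\mathcal{S}_n$ denotes the set of permutations of $[n]=\{1,\dots,n\}$. A permutation $\sigma\in\mathcal{S}_n$ contains a pattern $\pi\in\mathcal{S}_k$ if there are indices $1\le x_1<\dots<x_k\le n$ such that for all $1\le i,j\le k$, $\sigma(x_i)<\sigma(x_j)$ if and only if $\pi(i)<\pi(j)$. (In the paper the set is explicit: $\mathcal{Q}_k$ is the set of $\pi\in\mathcal{S}_k$ with $L_\Delta(\pi)\le 3\sqrt{k}$ for all $\Delta\in[k]$, where $L_\Delta(\pi)$ is the largest $L$ for which there exist $L$-element sets $A=\{a_1<\dots<a_L\}$, $B=\{b_1<\dots<b_L\}\subseteq[k]$ with $\pi(a_i)=\pi(b_i)+\Delta$ for all $i$.) *)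

theory Defs
  imports "HOL-Probability.Probability" "HOL-Combinatorics.Permutations"
begin

text \<open>Permutations of \<open>{1..n}\<close> are functions on \<open>nat\<close> that permute \<open>{1..n}\<close> and fix
  everything else, so that distinct elements of \<open>Sym n\<close> differ on \<open>{1..n}\<close>.\<close>

definition Sym :: "nat \<Rightarrow> (nat \<Rightarrow> nat) set" where
  "Sym n = {\<sigma>. \<sigma> permutes {1..n}}"

text \<open>Since functions do not determine their lengths (the identity lies in every \<open>Sym n\<close>),
  \<open>contains_pattern n \<sigma> k \<pi>\<close> takes the length \<open>n\<close> of \<open>\<sigma>\<close> and the length \<open>k\<close> of \<open>\<pi>\<close> as
  arguments.\<close>

definition contains_pattern :: "nat \<Rightarrow> (nat \<Rightarrow> nat) \<Rightarrow> nat \<Rightarrow> (nat \<Rightarrow> nat) \<Rightarrow> bool" where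
  "contains_pattern n \<sigma> k \<pi> \<longleftrightarrow>
    (\<exists>x :: nat \<Rightarrow> nat. x ` {1..k} \<subseteq> {1..n} \<and> strict_mono_on {1..k} x \<and>
      (\<forall>i\<in>{1..k}. \<forall>j\<in>{1..k}. \<sigma> (x i) < \<sigma> (x j) \<longleftrightarrow> \<pi> i < \<pi> j))"

end

theory Submission
  imports Defs "HOL-Combinatorics.Multiset_Permutations" "HOL-Real_Asymp.Real_Asymp"
begin

text \<open>
  Split the values of \<open>\<sigma>\<close> into \<open>2k\<close> blocks of \<open>10k\<close> consecutive values. For every shift \<open>j\<close> below
  some \<open>T\<close> that grows faster than \<open>ln k\<close>, try to embed \<open>\<pi>\<close> greedily from left to right, taking for
  position \<open>i\<close> of \<open>\<pi>\<close> the next entry of \<open>\<sigma>\<close> that lies in block \<open>\<pi> i - 1 + j\<close>. If the \<open>T\<close> scans always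
  waited for different blocks, the number of hits would concentrate around \<open>10 k T\<close>, whereas the
  failure of all scans means fewer than \<open>k T\<close> hits. This has probability \<open>exp (- c k T)\<close>, which beats
  the union bound over \<open>k!\<close> patterns.

  Two scans that wait for the same block advance together, and the pairs of positions at which this
  happens form an increasing chain of pairs \<open>(a, b)\<close> with \<open>\<pi> a = \<pi> b + d\<close>. Almost all \<open>\<pi>\<close> have only
  chains of length \<open>o(k)\<close>. Moreover, with high probability every interval of \<open>k powr (17/16)\<close> positions
  of \<open>\<sigma>\<close> meets every block, so that each coincidence is short. This last event does not depend on \<open>\<pi>\<close>,
  so it needs no union bound over patterns.
\<close>

section \<open>Counting permutations\<close>

text \<open>Reveal the entries one by one. As long as \<open>S\<close> is avoided, only values
  outside \<open>S\<close> are used up, so the density of \<open>S\<close> among the remaining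
  values never drops and every entry contributes a factor of at most
  \<open>1 - card S / card V\<close>.\<close>

lemma card_permutations_avoiding_prefix:
  assumes "finite V" "S \<subseteq> V" "S \<noteq> {}"
  shows "real (card {xs \<in> permutations_of_set V. set (take W xs) \<inter> S = {}})
         \<le> (1 - card S / card V) ^ W * fact (card V)"
  using assms
proof (induction W arbitrary: V)
  case 0
  then show ?case by simp
next
  case (Suc W)
  let ?G = "\<lambda>V W. {xs \<in> permutations_of_set V. set (take W xs) \<inter> S = {}}"
  define n where "n = card V"
  define m where "m = card S"
  have "V \<noteq> {}" using Suc.prems by auto
  hence n: "n > 0" using Suc.prems(1) by (simp add: n_def card_gt_0_iff)
  have mn: "m \<le> n" using Suc.prems card_mono n_def m_def by blast
  have m: "m > 0" using Suc.prems finite_subset by (auto simp: m_def card_gt_0_iff)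
  have G: "?G V (Suc W) = (\<Union>x\<in>V - S. (#) x ` ?G (V - {x}) W)"
    by (subst permutations_of_set_nonempty[OF \<open>V \<noteq> {}\<close>]) auto
  have "card (?G V (Suc W)) \<le> (\<Sum>x\<in>V - S. card ((#) x ` ?G (V - {x}) W))"
    unfolding G using Suc.prems by (intro card_UN_le) auto
  also have "\<dots> = (\<Sum>x\<in>V - S. card (?G (V - {x}) W))"
    by (intro sum.cong card_image) auto
  finally have "real (card (?G V (Suc W))) \<le> (\<Sum>x\<in>V - S. real (card (?G (V - {x}) W)))"
    by (simp only: of_nat_le_iff flip: of_nat_sum)
  also have "\<dots> \<le> (\<Sum>x\<in>V - S. (1 - m / n) ^ W * fact (n - 1))"
  proof (rule sum_mono)
    fix x assume x: "x \<in> V - S"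
    have "S \<subseteq> V - {x}" using x Suc.prems by auto
    hence c: "m \<le> n - 1" using card_mono[of "V - {x}" S] Suc.prems x
      by (simp add: m_def n_def)
    have "real (card (?G (V - {x}) W)) \<le> (1 - m / (n - 1)) ^ W * fact (n - 1)"
      using Suc.IH[of "V - {x}"] Suc.prems x \<open>S \<subseteq> V - {x}\<close> by (simp add: m_def n_def)
    also have "\<dots> \<le> (1 - m / n) ^ W * fact (n - 1)"
    proof (intro mult_right_mono power_mono)
      show "1 - real m / real (n - 1) \<le> 1 - real m / real n"
        using c m by (simp add: frac_le)
      show "0 \<le> 1 - real m / real (n - 1)"
        using c m by simp
    qed simp
    finally show "real (card (?G (V - {x}) W)) \<le> (1 - m / n) ^ W * fact (n - 1)" .
  qed
  also have "\<dots> = real (n - m) * ((1 - m / n) ^ W * fact (n - 1))"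
    using Suc.prems by (simp add: card_Diff_subset finite_subset m_def n_def)
  also have "\<dots> = (1 - m / n) ^ Suc W * fact n"
    using n mn by (simp add: fact_reduce of_nat_diff field_simps)
  finally show ?case by (simp add: n_def m_def)
qed

lemma card_permutations_avoiding_window:
  assumes "finite V" "S \<subseteq> V" "S \<noteq> {}" "s + W \<le> card V"
  shows "real (card {xs \<in> permutations_of_set V. set (take W (drop s xs)) \<inter> S = {}})
         \<le> (1 - card S / card V) ^ W * fact (card V)"
proof -
  let ?A = "{xs \<in> permutations_of_set V. set (take W (drop s xs)) \<inter> S = {}}"
  let ?B = "{xs \<in> permutations_of_set V. set (take W xs) \<inter> S = {}}"
  have len: "length xs = card V" if "xs \<in> permutations_of_set V" for xs
    using that length_finite_permutations_of_set by blast
  have "card ?A \<le> card ?B"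
  \<comment> \<open>Rotating by \<open>s\<close> moves the window to the front and keeps the list a
    permutation of \<open>V\<close>. It can be undone because all lists have the same
    length.\<close>
  proof (rule card_inj_on_le[of "\<lambda>xs. drop s xs @ take s xs"])
    show "inj_on (\<lambda>xs. drop s xs @ take s xs) ?A"
    proof (rule inj_onI)
      fix xs ys assume *: "xs \<in> ?A" "ys \<in> ?A" "drop s xs @ take s xs = drop s ys @ take s ys"
      hence "length xs = length ys" using len by simp
      hence "drop s xs = drop s ys \<and> take s xs = take s ys"
        using *(3) by (subst (asm) append_eq_append_conv) auto
      thus "xs = ys" by (metis append_take_drop_id)
    qed
    show "(\<lambda>xs. drop s xs @ take s xs) ` ?A \<subseteq> ?B"
    proof (clarify, intro conjI CollectI)
      fix xs assume *: "xs \<in> permutations_of_set V" "set (take W (drop s xs)) \<inter> S = {}"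
      have "length (drop s xs) \<ge> W" using len[OF *(1)] assms by simp
      thus "set (take W (drop s xs @ take s xs)) \<inter> S = {}" using *(2) by simp
      have "set (drop s xs @ take s xs) = set xs" "distinct (drop s xs @ take s xs)"
        using permutations_of_setD(2)[OF *(1)]
         by (metis append_take_drop_id set_append Un_commute)
            (metis permutations_of_setD(2)[OF *(1)] append_take_drop_id distinct_append inf_commute)
      thus "drop s xs @ take s xs \<in> permutations_of_set V"
        using * by (simp add: permutations_of_set_def)
    qed
  qed simp
  thus ?thesis using card_permutations_avoiding_prefix[OF assms(1-3), of W] by linarith
qed

lemma card_distinct_lists_with_colours:
  fixes col :: "'a \<Rightarrow> nat"
  assumes "finite V" "col ` V \<subseteq> {..<R}"
  shows "card {xs. distinct xs \<and> set xs \<subseteq> V \<and> map col xs = ys}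
         \<le> (\<Prod>r<R. fact (card {v\<in>V. col v = r}))"
  using assms
proof (induction ys arbitrary: V)
  case Nil
  have "{xs. distinct xs \<and> set xs \<subseteq> V \<and> map col xs = []} = {[]}" by auto
  moreover have "(1::nat) \<le> (\<Prod>r<R. fact (card {v\<in>V. col v = r}))"
    by (intro prod_ge_1) auto
  ultimately show ?case by simp
next
  case (Cons y ys)
  let ?G = "\<lambda>V ys. {xs. distinct xs \<and> set xs \<subseteq> V \<and> map col xs = ys}"
  let ?c = "\<lambda>V r. card {v\<in>V. col v = r}"
  let ?V = "{v\<in>V. col v = y}"
  have fin: "finite (?G U zs)" if "finite U" for U zs
    by (rule finite_subset[OF _ finite_subset_distinct[OF that]]) auto
  have G: "?G V (y # ys) = (\<Union>x\<in>?V. (#) x ` ?G (V - {x}) ys)"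
    by (fastforce simp: map_eq_Cons_conv)
  have "card (?G V (y # ys)) \<le> (\<Sum>x\<in>?V. card ((#) x ` ?G (V - {x}) ys))"
    unfolding G using Cons.prems by (intro card_UN_le) auto
  also have "\<dots> \<le> (\<Sum>x\<in>?V. \<Prod>r<R. fact (?c (V - {x}) r))"
  proof (rule sum_mono)
    fix x assume "x \<in> ?V"
    have "card ((#) x ` ?G (V - {x}) ys) \<le> card (?G (V - {x}) ys)"
      using fin Cons.prems by (intro card_image_le) auto
    also have "\<dots> \<le> (\<Prod>r<R. fact (?c (V - {x}) r))"
      using Cons.IH[of "V - {x}"] Cons.prems by auto
    finally show "card ((#) x ` ?G (V - {x}) ys) \<le> (\<Prod>r<R. fact (?c (V - {x}) r))" .
  qed
  also have "\<dots> = (\<Sum>x\<in>?V. fact (?c V y - 1) * (\<Prod>r\<in>{..<R} - {y}. fact (?c V r)))"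
  proof (rule sum.cong[OF refl])
    fix x assume x: "x \<in> ?V"
    hence y: "y < R" using Cons.prems by auto
    have 1: "{v\<in>V - {x}. col v = y} = ?V - {x}" by auto
    have 2: "{v\<in>V - {x}. col v = r} = {v\<in>V. col v = r}" if "r \<noteq> y" for r using x that by auto
    have "(\<Prod>r<R. fact (?c (V - {x}) r)) =
          fact (?c (V - {x}) y) * (\<Prod>r\<in>{..<R} - {y}. fact (?c (V - {x}) r) :: nat)"
      using y by (subst prod.remove[of _ y]) auto
    also have "fact (?c (V - {x}) y) = (fact (?c V y - 1) :: nat)"
      using x Cons.prems by (simp only: 1) (simp add: card_Diff_singleton)
    also have "(\<Prod>r\<in>{..<R} - {y}. fact (?c (V - {x}) r) :: nat) = (\<Prod>r\<in>{..<R} - {y}. fact (?c V r))"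
      by (intro prod.cong refl arg_cong[of _ _ fact] arg_cong[of _ _ card] 2) auto
    finally show "(\<Prod>r<R. fact (?c (V - {x}) r)) =
      fact (?c V y - 1) * (\<Prod>r\<in>{..<R} - {y}. fact (?c V r) :: nat)" .
  qed
  also have "\<dots> = ?c V y * fact (?c V y - 1) * (\<Prod>r\<in>{..<R} - {y}. fact (?c V r))"
    by simp
  also have "\<dots> \<le> (\<Prod>r<R. fact (?c V r))"
  \<comment> \<open>The letter \<open>y\<close> need not be below \<open>R\<close>; whenever its
    class is empty, the left side vanishes.\<close>
  proof (cases "?V = {}")
    case False
    hence "y < R" "?c V y > 0" using Cons.prems by (auto simp: card_gt_0_iff)
    thus ?thesis by (subst (2) prod.remove[of _ y]) (auto simp: fact_reduce)
  next
    case True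
    thus ?thesis by (simp only: True) simp
  qed
  finally show ?case .
qed

section \<open>Greedy scans and their coincidences\<close>

text \<open>Greedy matching of the infinite word \<open>w 0, w 1, ...\<close>: the value is the
  length of its longest prefix that is a subsequence of \<open>ys\<close>, and also the index of the
  letter awaited next.\<close>

definition scan :: "(nat \<Rightarrow> nat) \<Rightarrow> nat list \<Rightarrow> nat" where
  "scan w ys = foldl (\<lambda>p y. if y = w p then Suc p else p) 0 ys"

lemma scan_Nil [simp]: "scan w [] = 0"
  by (simp add: scan_def)

lemma scan_snoc [simp]: "scan w (ys @ [y]) = (if y = w (scan w ys) then Suc (scan w ys) else scan w ys)"
  by (simp add: scan_def)

lemma scan_take_Suc:
  assumes "t < length ys"
  shows "scan w (take (Suc t) ys) =
    (if ys ! t = w (scan w (take t ys)) then Suc (scan w (take t ys)) else scan w (take t ys))"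
  using assms by (simp add: take_Suc_conv_app_nth)

lemma scan_take_mono:
  assumes "s \<le> t" "t \<le> length ys"
  shows "scan w (take s ys) \<le> scan w (take t ys)"
  using assms
proof (induction t rule: dec_induct)
  case (step t)
  thus ?case by (simp add: scan_take_Suc)
qed simp

text \<open>A scan stands still exactly until its awaited letter turns up. Hence two scans that
  await the same letter leave their states at the same moment.\<close>

lemma scan_take_eq_iff:
  assumes "s \<le> t" "t \<le> length ys"
  shows "scan w (take t ys) = scan w (take s ys) \<longleftrightarrow> (\<forall>u\<in>{s..<t}. ys ! u \<noteq> w (scan w (take s ys)))"
  using assms
proof (induction t rule: dec_induct)
  case (step t)
  have "scan w (take s ys) \<le> scan w (take t ys)" using step by (intro scan_take_mono) auto
  thus ?case using step by (auto simp: scan_take_Suc less_Suc_eq)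
qed simp

lemma scan_eq_card: "scan w ys = card {t. t < length ys \<and> ys ! t = w (scan w (take t ys))}"
proof (induction ys rule: rev_induct)
  case (snoc y ys)
  let ?S = "\<lambda>ys. {t. t < length ys \<and> ys ! t = w (scan w (take t ys))}"
  have "?S (ys @ [y]) = ?S ys \<union> (if y = w (scan w ys) then {length ys} else {})"
    by (auto simp: nth_append less_Suc_eq split: if_splits)
  thus ?case using snoc by auto
qed simp

lemma scan_embedding:
  "\<exists>x. strict_mono_on {1..scan w ys} x \<and>
    (\<forall>i\<in>{1..scan w ys}. x i \<in> {1..length ys} \<and> ys ! (x i - 1) = w (i - 1))"
proof (induction ys rule: rev_induct)
  case (snoc y ys)
  then obtain x where x: "strict_mono_on {1..scan w ys} x"
    "\<And>i. i\<in>{1..scan w ys} \<Longrightarrow> x i \<in> {1..length ys} \<and> ys ! (x i - 1) = w (i - 1)"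
    by blast
  have nth: "(ys @ [y]) ! (x i - 1) = ys ! (x i - 1)" if "i\<in>{1..scan w ys}" for i
    using x(2)[OF that] by (auto simp: nth_append)
  show ?case
  proof (cases "y = w (scan w ys)")
    case False
    have "scan w (ys @ [y]) = scan w ys" using False by simp
    moreover have "x i \<in> {1..length (ys @ [y])} \<and> (ys @ [y]) ! (x i - 1) = w (i - 1)"
      if "i \<in> {1..scan w ys}" for i
      using x(2)[OF that] nth[OF that] by auto
    ultimately show ?thesis using x(1) by (intro exI[of _ x]) auto
  next
    case True
    define p where "p = scan w ys"
    \<comment> \<open>Positions in \<open>x\<close> count from 1, those in lists and in
      \<open>w\<close> from 0.\<close>
    define x' where "x' = x(Suc p := Suc (length ys))"
    have p: "scan w (ys @ [y]) = Suc p" using True by (simp add: p_def)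
    have "strict_mono_on {1..Suc p} x'"
    proof (rule strict_mono_onI)
      fix i j assume ij: "i \<in> {1..Suc p}" "j \<in> {1..Suc p}" "i < j"
      hence i: "i \<in> {1..p}" by auto
      show "x' i < x' j"
      proof (cases "j = Suc p")
        case True
        have "x i \<le> length ys" using x(2)[of i] i by (auto simp: p_def)
        thus ?thesis using True i by (simp add: x'_def)
      next
        case False
        thus ?thesis using ij i x(1) by (auto simp: x'_def p_def strict_mono_on_def)
      qed
    qed
    moreover have "x' i \<in> {1..length (ys @ [y])} \<and> (ys @ [y]) ! (x' i - 1) = w (i - 1)"
      if "i \<in> {1..Suc p}" for i
    proof (cases "i = Suc p")
      case True
      thus ?thesis using \<open>y = w (scan w ys)\<close> by (simp add: x'_def p_def)
    next
      case False
      hence "i \<in> {1..scan w ys}" using that by (auto simp: p_def)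
      from x(2)[OF this] nth[OF this] False show ?thesis by (auto simp: x'_def)
    qed
    ultimately show ?thesis unfolding p by blast
  qed
qed (auto simp: strict_mono_on_def)

text \<open>The equivalence also excludes distinct pairs that agree in one coordinate, so these sets
  are the graphs of strictly increasing partial functions.\<close>

definition chain2 :: "(nat \<times> nat) set \<Rightarrow> bool" where
  "chain2 P \<longleftrightarrow> (\<forall>p\<in>P. \<forall>q\<in>P. fst p < fst q \<longleftrightarrow> snd p < snd q)"

definition windows_full :: "nat \<Rightarrow> nat \<Rightarrow> nat list \<Rightarrow> bool" where
  "windows_full R W ys \<longleftrightarrow> (\<forall>s r. s + W \<le> length ys \<longrightarrow> r < R \<longrightarrow> r \<in> set (take W (drop s ys)))"

definition coincidences :: "(nat \<Rightarrow> nat) \<Rightarrow> (nat \<Rightarrow> nat) \<Rightarrow> nat list \<Rightarrow> nat set" where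
  "coincidences v w ys = {t. t < length ys \<and> v (scan v (take t ys)) = w (scan w (take t ys))}"

text \<open>Group the coincidence times by the joint state of the two scans. Scans that await the
  same letter advance together, so the joint states form a chain and there are at most
  \<open>L\<close> of them. Each state lasts at most \<open>W\<close> steps, because the awaited
  letter occurs in every window.\<close>

lemma card_coincidences_le:
  assumes full: "windows_full R W ys"
  assumes v: "\<And>p. p < k \<Longrightarrow> v p < R" and kv: "scan v ys < k" and kw: "scan w ys < k"
  assumes chain: "\<And>P. \<lbrakk>P \<subseteq> {..<k} \<times> {..<k}; chain2 P; \<forall>p\<in>P. v (fst p) = w (snd p)\<rbrakk> \<Longrightarrow> card P \<le> L"
  shows "card (coincidences v w ys) \<le> L * W"
proof -
  define C where "C = coincidences v w ys"
  define st where "st t = (scan v (take t ys), scan w (take t ys))" for t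
  have C: "t < length ys" "v (fst (st t)) = w (snd (st t))" if "t \<in> C" for t
    using that by (auto simp: C_def coincidences_def st_def)
  have finC: "finite C" by (auto simp: C_def coincidences_def)
  have lt: "fst (st t) < k" "snd (st t) < k" if "t \<in> C" for t
    using scan_take_mono[of t "length ys" ys v] scan_take_mono[of t "length ys" ys w] C[OF that] kv kw
    by (auto simp: st_def)
  \<comment> \<open>At a time in \<open>C\<close> both scans await the same letter, so a change of
    one coordinate of the state forces a change of the other.\<close>
  have const: "st t = st s \<longleftrightarrow> (\<forall>u\<in>{s..<t}. ys ! u \<noteq> v (fst (st s)))"
     "fst (st t) = fst (st s) \<longleftrightarrow> st t = st s" "snd (st t) = snd (st s) \<longleftrightarrow> st t = st s"
    if "s \<in> C" "s \<le> t" "t \<le> length ys" for s t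
    using scan_take_eq_iff[OF that(2,3), of v] scan_take_eq_iff[OF that(2,3), of w] C[OF that(1)]
    by (auto simp: st_def)
  have mono: "fst (st s) \<le> fst (st t)" "snd (st s) \<le> snd (st t)" if "s \<le> t" "t \<in> C" for s t
    using scan_take_mono[of s t ys] C[OF that(2)] that by (auto simp: st_def)
  have lex: "fst (st s) < fst (st t) \<longleftrightarrow> snd (st s) < snd (st t)"
    if "s \<in> C" "t \<in> C" for s t
  proof (cases "s \<le> t")
    case True
    thus ?thesis using const(2,3)[of s t] mono[of s t] that C(1)[OF that(2)]
      by (metis less_le less_imp_le)
  next
    case False
    hence "t \<le> s" by simp
    thus ?thesis using const(2,3)[of t s] mono[of t s] that C(1)[OF that(1)]
      by (metis leD less_imp_le)
  qed
  have "card (st ` C) \<le> L"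
  proof (rule chain)
    show "st ` C \<subseteq> {..<k} \<times> {..<k}" using lt by (intro image_subsetI) (simp add: mem_Times_iff)
    show "chain2 (st ` C)" using lex by (simp add: chain2_def)
    show "\<forall>p\<in>st ` C. v (fst p) = w (snd p)" using C by auto
  qed
  moreover have "card {t\<in>C. st t = p} \<le> W" if "p \<in> st ` C" for p
  proof -
    let ?A = "{t\<in>C. st t = p}"
    have A: "finite ?A" "?A \<noteq> {}" using that finC by auto
    define s where "s = Min ?A"
    have s: "s \<in> C" "st s = p" using Min_in[OF A] by (auto simp: s_def)
    \<comment> \<open>The window of length \<open>W\<close> from the first time \<open>s\<close>
      contains the awaited letter, after which the state \<open>p\<close> cannot recur.\<close>
    have "?A \<subseteq> {s..<s + W}"
    proof
      fix t assume t: "t \<in> ?A"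
      hence "s \<le> t" using A by (auto simp: s_def)
      moreover have "t < s + W"
      proof (rule ccontr)
        assume "\<not> t < s + W"
        hence tW: "s + W \<le> t" by simp
        have tl: "t < length ys" using t C by auto
        have "v (fst (st s)) < R" using lt[OF s(1)] v by auto
        hence "v (fst (st s)) \<in> set (take W (drop s ys))"
          using full tW tl by (auto simp: windows_full_def)
        then obtain u where "u < W" "ys ! (s + u) = v (fst (st s))"
          using tW tl by (auto simp: in_set_conv_nth)
        moreover have "\<forall>u\<in>{s..<t}. ys ! u \<noteq> v (fst (st s))"
          using const(1)[OF s(1) \<open>s \<le> t\<close>] tl t s by auto
        ultimately show False using tW by auto
      qed
      ultimately show "t \<in> {s..<s + W}" by simp
    qed
    from card_mono[OF _ this] show ?thesis by simp
  qed
  moreover have "card C = (\<Sum>p\<in>st ` C. card {t\<in>C. st t = p})"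
    using sum.image_gen[OF finC, of "\<lambda>_. 1::nat" st] by simp
  ultimately have "card C \<le> card (st ` C) * W"
    using sum_bounded_above[of "st ` C" "\<lambda>p. card {t\<in>C. st t = p}" W] by simp
  also have "\<dots> \<le> L * W" using \<open>card (st ` C) \<le> L\<close> by simp
  finally show ?thesis by (simp add: C_def)
qed

lemma le_card_image_plus_collisions:
  fixes f :: "nat \<Rightarrow> 'a"
  shows "T \<le> card (f ` {..<T}) + card {(i, j). i < j \<and> j < T \<and> f i = f j}"
proof -
  define J where "J = {j. j < T \<and> (\<forall>i<j. f i \<noteq> f j)}"
  let ?P = "{(i, j). i < j \<and> j < T \<and> f i = f j}"
  have finP: "finite ?P" by (rule finite_subset[of _ "{..<T} \<times> {..<T}"]) auto
  have "inj_on f J" unfolding J_def inj_on_def by (metis (mono_tags, lifting) linorder_neqE_nat mem_Collect_eq)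
  hence "card J \<le> card (f ` {..<T})" by (rule card_inj_on_le) (auto simp: J_def)
  moreover have "{..<T} - J \<subseteq> snd ` ?P" by (force simp: J_def)
  hence "card ({..<T} - J) \<le> card ?P" by (rule surj_card_le[OF finP])
  moreover have "T = card J + card ({..<T} - J)"
    using card_Un_disjoint[of J "{..<T} - J"] by (auto simp: J_def Un_absorb1 subset_iff)
  ultimately show ?thesis by linarith
qed

section \<open>The probability that all scans fail\<close>

text \<open>Split off the last letter: by hypothesis its factors sum to at most \<open>R\<close>,
  whatever came before. For a uniformly random word this says that the exponential has expectation
  at most 1.\<close>

lemma sum_exp_supermartingale:
  fixes g :: "nat list \<Rightarrow> nat \<Rightarrow> real"
  assumes "\<And>ys. (\<Sum>r<R. exp (g ys r)) \<le> R"
  shows "(\<Sum>ys | length ys = n \<and> set ys \<subseteq> {..<R}. exp (\<Sum>t<n. g (take t ys) (ys ! t))) \<le> real R ^ n"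
proof (induction n)
  case 0
  have "{ys :: nat list. length ys = 0 \<and> set ys \<subseteq> {..<R}} = {[]}" by auto
  thus ?case by simp
next
  case (Suc n)
  let ?A = "\<lambda>n. {ys. length ys = n \<and> set ys \<subseteq> {..<R}}"
  let ?E = "\<lambda>n ys. exp (\<Sum>t<n. g (take t ys) (ys ! t))"
  have bij: "bij_betw (\<lambda>(ys, r). ys @ [r]) (?A n \<times> {..<R}) (?A (Suc n))"
  proof (rule bij_betwI[where g = "\<lambda>ys. (butlast ys, last ys)"])
    show "(\<lambda>ys. (butlast ys, last ys)) \<in> ?A (Suc n) \<rightarrow> ?A n \<times> {..<R}"
    proof
      fix ys :: "nat list" assume "ys \<in> ?A (Suc n)"
      hence "ys \<noteq> []" "length ys = Suc n" "set ys \<subseteq> {..<R}" by auto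
      thus "(butlast ys, last ys) \<in> ?A n \<times> {..<R}"
        using last_in_set[of ys] by (auto dest: in_set_butlastD simp: subset_iff simp del: last_in_set)
    qed
    show "(case (butlast ys, last ys) of (ys, r) \<Rightarrow> ys @ [r]) = ys" if "ys \<in> ?A (Suc n)" for ys
    proof -
      have "ys \<noteq> []" using that by auto
      thus ?thesis by simp
    qed
  qed auto
  have E: "?E (Suc n) (ys @ [r]) = ?E n ys * exp (g ys r)" if "ys \<in> ?A n" for ys r
  proof -
    have "(\<Sum>t<n. g (take t (ys @ [r])) ((ys @ [r]) ! t)) = (\<Sum>t<n. g (take t ys) (ys ! t))"
      using that by (intro sum.cong) (auto simp: nth_append)
    thus ?thesis using that by (auto simp: exp_add nth_append)
  qed
  have "(\<Sum>ys\<in>?A (Suc n). ?E (Suc n) ys) = (\<Sum>(ys, r)\<in>?A n \<times> {..<R}. ?E (Suc n) (ys @ [r]))"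
    by (subst sum.reindex_bij_betw[OF bij, symmetric]) (simp add: case_prod_unfold)
  also have "\<dots> = (\<Sum>ys\<in>?A n. \<Sum>r<R. ?E (Suc n) (ys @ [r]))"
    by (rule sum.cartesian_product[symmetric])
  also have "\<dots> = (\<Sum>ys\<in>?A n. ?E n ys * (\<Sum>r<R. exp (g ys r)))"
    by (intro sum.cong refl) (simp only: E sum_distrib_left)
  also have "\<dots> \<le> (\<Sum>ys\<in>?A n. ?E n ys * R)"
    by (intro sum_mono mult_left_mono assms) auto
  also have "\<dots> = (\<Sum>ys\<in>?A n. ?E n ys) * R" by (simp add: sum_distrib_right)
  also have "\<dots> \<le> real R ^ n * R" by (intro mult_right_mono Suc.IH) auto
  finally show ?case by (simp add: mult.commute)
qed

text \<open>A uniform letter hits \<open>N\<close> with probability \<open>q = card N / R\<close>,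
  and the mean of \<open>exp (- indicator)\<close> is \<open>1 - q (1 - 1/e)\<close>, which is at
  most \<open>1 - q/2\<close> and hence at most \<open>exp (- q/2)\<close>. The term
  \<open>q/2\<close> in the exponent compensates for this.\<close>

lemma sum_exp_neg_indicator_le:
  assumes "N \<subseteq> {..<R}"
  shows "(\<Sum>r<R. exp (card N / (2 * real R) - of_bool (r \<in> N))) \<le> real R"
proof (cases "R = 0")
  case False
  define q where "q = card N / real R"
  have cN: "card N \<le> R" using card_mono[OF _ assms] by simp
  have "(\<Sum>r<R. exp (card N / (2 * real R) - of_bool (r \<in> N)))
      = exp (q / 2) * (\<Sum>r<R. exp (- of_bool (r \<in> N) :: real))"
    unfolding sum_distrib_left exp_add[symmetric] q_def
    by (intro sum.cong refl arg_cong[of _ _ exp]) simp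
  also have "(\<Sum>r<R. exp (- of_bool (r \<in> N) :: real)) = (\<Sum>r\<in>N. exp (-1)) + (\<Sum>r\<in>{..<R} - N. 1)"
    by (subst sum.subset_diff[OF assms]) (auto intro!: arg_cong2[of _ _ _ _ "(+)"] sum.cong)
  also have "\<dots> = card N * exp (-1) + (real R - card N)"
    using assms cN by (simp add: card_Diff_subset finite_subset of_nat_diff)
  also have "\<dots> = R * (1 - q * (1 - exp (-1)))"
    using False by (simp add: q_def field_simps)
  also have "\<dots> \<le> R * (1 - q / 2)"
  proof -
    have "exp (-1) \<le> (1 / 2 :: real)"
      using exp_ge_add_one_self[of 1] by (simp add: exp_minus field_simps)
    hence "q * (1 / 2) \<le> q * (1 - exp (-1))"
      by (intro mult_left_mono) (auto simp: q_def)
    thus ?thesis by (intro mult_left_mono) auto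
  qed
  also have "\<dots> \<le> R * exp (- (q / 2))"
    using exp_ge_add_one_self[of "- (q / 2)"] by (intro mult_left_mono) auto
  finally have "(\<Sum>r<R. exp (card N / (2 * real R) - of_bool (r \<in> N))) \<le> exp (q / 2) * (R * exp (- (q / 2)))"
    by (simp add: mult_left_mono)
  also have "\<dots> = R" by (simp add: exp_minus field_simps)
  finally show ?thesis .
qed simp

text \<open>The exponential supermartingale weighs a hit against the number of distinct colours the
  \<open>T\<close> scans are waiting for. Coincidences are the only reason why this number can be below \<open>T\<close>.\<close>

lemma card_all_scans_fail:
  fixes w :: "nat \<Rightarrow> nat \<Rightarrow> nat"
  assumes R: "\<And>j p. j < T \<Longrightarrow> p < k \<Longrightarrow> w j p < R"
  assumes chain: "\<And>i j P. \<lbrakk>i < j; j < T; P \<subseteq> {..<k} \<times> {..<k}; chain2 P;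
      \<forall>p\<in>P. w i (fst p) = w j (snd p)\<rbrakk> \<Longrightarrow> card P \<le> L"
  shows "card {ys. length ys = n \<and> set ys \<subseteq> {..<R} \<and> windows_full R W ys \<and> (\<forall>j<T. scan (w j) ys < k)}
      * exp ((real T * n - real T ^ 2 * L * W) / (2 * real R) - real k * T) \<le> real R ^ n"
proof -
  define F where "F = {ys. length ys = n \<and> set ys \<subseteq> {..<R} \<and> windows_full R W ys \<and> (\<forall>j<T. scan (w j) ys < k)}"
  \<comment> \<open>The supermartingale runs over all words, and outside \<open>F\<close> a scan may
    pass \<open>k\<close> and await a letter beyond \<open>R\<close>; the intersection keeps
    \<open>N\<close> inside the alphabet. On prefixes of words in \<open>F\<close> it removes
    nothing.\<close>
  define N where "N ys = (\<lambda>j. w j (scan (w j) ys)) ` {..<T} \<inter> {..<R}" for ys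
  define g where "g ys r = card (N ys) / (2 * real R) - of_bool (r \<in> N ys)" for ys r
  let ?A = "{ys. length ys = n \<and> set ys \<subseteq> {..<R}}"
  let ?e = "(real T * n - real T ^ 2 * L * W) / (2 * real R) - real k * T"
  have finA: "finite ?A" using finite_lists_length_eq[of "{..<R}" n] by (simp add: conj_commute)
  have low: "?e \<le> (\<Sum>t<n. g (take t ys) (ys ! t))" if ys: "ys \<in> F" for ys
  proof -
    have len: "length ys = n" and full: "windows_full R W ys" and lt: "\<And>j. j < T \<Longrightarrow> scan (w j) ys < k"
      using ys by (auto simp: F_def)
    have lt': "scan (w j) (take t ys) < k" if "j < T" "t < n" for j t
      using scan_take_mono[of t n ys "w j"] that lt[OF that(1)] len by auto
    let ?P = "{(i, j). i < j \<and> j < T}"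
    have P: "?P \<subseteq> {..<T} \<times> {..<T}" by auto
    have finP: "finite ?P" by (rule finite_subset[OF P]) auto
    have cP: "card ?P \<le> T * T" using card_mono[OF _ P] by simp
    let ?eq = "\<lambda>t p. w (fst p) (scan (w (fst p)) (take t ys)) = w (snd p) (scan (w (snd p)) (take t ys))"
    \<comment> \<open>At each time the number of distinct awaited letters falls short of
      \<open>T\<close> by at most the number of coinciding pairs. Summed over time, each pair costs
      at most \<open>L * W\<close>.\<close>
    have "T \<le> card (N (take t ys)) + (\<Sum>p\<in>?P. of_bool (?eq t p))" if t: "t < n" for t
    proof -
      let ?f = "\<lambda>j. w j (scan (w j) (take t ys))"
      have "N (take t ys) = ?f ` {..<T}"
        using R lt' t unfolding N_def by (intro Int_absorb2) auto
      moreover have "card {(i, j). i < j \<and> j < T \<and> ?f i = ?f j} = (\<Sum>p\<in>?P. of_bool (?eq t p))"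
        using finP by (simp add: of_bool_def sum.If_cases)
            (rule arg_cong[of _ _ card], auto)
      ultimately show ?thesis using le_card_image_plus_collisions[of T ?f] by simp
    qed
    hence "(\<Sum>t<n. T) \<le> (\<Sum>t<n. card (N (take t ys)) + (\<Sum>p\<in>?P. of_bool (?eq t p)))"
      by (intro sum_mono) auto
    also have "\<dots> = (\<Sum>t<n. card (N (take t ys))) + (\<Sum>p\<in>?P. \<Sum>t<n. of_bool (?eq t p))"
      by (simp add: sum.distrib sum.swap[of _ ?P])
    also have "(\<Sum>p\<in>?P. \<Sum>t<n. of_bool (?eq t p)) \<le> (\<Sum>p\<in>?P. L * W)"
    proof (rule sum_mono)
      fix p assume p: "p \<in> ?P"
      obtain i j where ij: "p = (i, j)" "i < j" "j < T" using p by auto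
      have "(\<Sum>t<n. of_bool (?eq t p)) = card (coincidences (w i) (w j) ys)"
        unfolding coincidences_def using len
        by (simp add: of_bool_def sum.If_cases ij(1))
           (rule arg_cong[of _ _ card], auto)
      also have "\<dots> \<le> L * W"
        using ij by (intro card_coincidences_le[OF full, of k] R lt chain[of i j]) auto
      finally show "(\<Sum>t<n. of_bool (?eq t p)) \<le> L * W" .
    qed
    also have "(\<Sum>p\<in>?P. L * W) \<le> T * T * (L * W)" using cP by simp
    finally have "n * T \<le> (\<Sum>t<n. card (N (take t ys))) + T * T * (L * W)" by simp
    hence "real (n * T) \<le> real ((\<Sum>t<n. card (N (take t ys))) + T * T * (L * W))"
      by (simp only: of_nat_le_iff)
    hence wait: "real T * n - real T ^ 2 * L * W \<le> (\<Sum>t<n. real (card (N (take t ys))))"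
      by (simp add: power2_eq_square algebra_simps)
    \<comment> \<open>Every hit advances at least one scan, so the hits number at most the sum of
      the final scan positions, all of which are below \<open>k\<close>.\<close>
    have "(\<Sum>t<n. of_bool (ys ! t \<in> N (take t ys))) \<le>
        (\<Sum>t<n. \<Sum>j<T. of_bool (ys ! t = w j (scan (w j) (take t ys))) :: nat)"
    proof (rule sum_mono)
      fix t
      show "of_bool (ys ! t \<in> N (take t ys)) \<le> (\<Sum>j<T. of_bool (ys ! t = w j (scan (w j) (take t ys))) :: nat)"
      proof (cases "ys ! t \<in> N (take t ys)")
        case True
        then obtain j where "j < T" "ys ! t = w j (scan (w j) (take t ys))" by (auto simp: N_def)
        thus ?thesis
          using member_le_sum[of j "{..<T}" "\<lambda>j. of_bool (ys ! t = w j (scan (w j) (take t ys))) :: nat"] True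
          by auto
      qed auto
    qed
    also have "\<dots> = (\<Sum>j<T. \<Sum>t<n. of_bool (ys ! t = w j (scan (w j) (take t ys))))"
      by (rule sum.swap)
    also have "\<dots> = (\<Sum>j<T. scan (w j) ys)"
      by (intro sum.cong refl, subst scan_eq_card)
         (simp add: of_bool_def sum.If_cases len, rule arg_cong[of _ _ card], auto)
    also have "\<dots> \<le> (\<Sum>j<T. k)" using lt by (intro sum_mono) (auto intro: less_imp_le)
    finally have "real (\<Sum>t<n. of_bool (ys ! t \<in> N (take t ys))) \<le> real (T * k)"
      by (simp only: of_nat_le_iff) simp
    hence hits: "(\<Sum>t<n. of_bool (ys ! t \<in> N (take t ys)) :: real) \<le> real T * k"
      by simp
    have "?e \<le> (\<Sum>t<n. real (card (N (take t ys)))) / (2 * real R) - (\<Sum>t<n. of_bool (ys ! t \<in> N (take t ys)))"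
      using hits by (intro diff_mono divide_right_mono wait) (simp, simp only: mult.commute)
    thus ?thesis by (simp add: g_def sum_subtractf sum_divide_distrib)
  qed
  \<comment> \<open>Markov's inequality in counting form.\<close>
  have "card F * exp ?e = (\<Sum>ys\<in>F. exp ?e)" by simp
  also have "\<dots> \<le> (\<Sum>ys\<in>F. exp (\<Sum>t<n. g (take t ys) (ys ! t)))"
    using low by (intro sum_mono) auto
  also have "\<dots> \<le> (\<Sum>ys\<in>?A. exp (\<Sum>t<n. g (take t ys) (ys ! t)))"
    using finA by (intro sum_mono2) (auto simp: F_def)
  also have "\<dots> \<le> real R ^ n"
    unfolding g_def by (intro sum_exp_supermartingale sum_exp_neg_indicator_le) (auto simp: N_def)
  finally show ?thesis by (simp add: F_def)
qed

section \<open>Patterns without long chains\<close>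

lemma chain2_inj:
  assumes "chain2 P"
  shows "inj_on fst P" "inj_on snd P"
proof -
  have "fst p = fst q \<longleftrightarrow> snd p = snd q" if "p \<in> P" "q \<in> P" for p q
    using assms that unfolding chain2_def by (metis nat_neq_iff)
  thus "inj_on fst P" "inj_on snd P" by (auto simp: inj_on_def prod_eq_iff)
qed

lemma chain2_subset: "chain2 P \<Longrightarrow> P' \<subseteq> P \<Longrightarrow> chain2 P'"
  by (auto simp: chain2_def)

lemma card_below_inj:
  fixes a b :: "'a :: linorder"
  assumes "finite A" "a \<in> A" "b \<in> A" "card {x\<in>A. x < a} = card {x\<in>A. x < b}"
  shows "a = b"
proof (rule ccontr)
  assume "a \<noteq> b"
  have less: "card {x\<in>A. x < c} < card {x\<in>A. x < d}" if "c < d" "c \<in> A" for c d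
    using that assms(1) by (intro psubset_card_mono) auto
  show False using less[of a b] less[of b a] assms \<open>a \<noteq> b\<close> by (metis linorder_neqE order_less_irrefl)
qed

text \<open>In a chain, the second coordinate of a pair has the same rank among all second
  coordinates as the first has among the first ones. The two projections therefore determine the
  pairing.\<close>

lemma chain2_subset_of_projections:
  assumes P: "chain2 P" "finite P" and P': "chain2 P'" and eq: "fst ` P = fst ` P'" "snd ` P = snd ` P'"
  shows "P \<subseteq> P'"
proof
  fix p assume p: "p \<in> P"
  have rank: "card {x\<in>fst ` Q. x < fst q} = card {x\<in>snd ` Q. x < snd q}"
    if Q: "chain2 Q" "q \<in> Q" for Q q
  proof -
    let ?S = "{x\<in>Q. fst x < fst q}"
    have "{x\<in>fst ` Q. x < fst q} = fst ` ?S" "{x\<in>snd ` Q. x < snd q} = snd ` ?S"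
      using Q by (auto simp: chain2_def)
    thus ?thesis using chain2_inj[OF chain2_subset[OF Q(1), of ?S]] by (simp add: card_image)
  qed
  have "fst p \<in> fst ` P'" using p eq(1) by (metis imageI)
  then obtain q where q: "q \<in> P'" "fst q = fst p" by auto
  have "card {x\<in>snd ` P. x < snd p} = card {x\<in>snd ` P. x < snd q}"
    using rank[OF P(1) p] rank[OF P' q(1)] eq q by simp
  moreover have "snd q \<in> snd ` P" using q eq by auto
  ultimately have "snd p = snd q"
    using card_below_inj[of "snd ` P" "snd p" "snd q"] p P(2) by simp
  hence "p = q" using q(2) by (simp add: prod_eq_iff)
  thus "p \<in> P'" using q(1) by simp
qed

text \<open>A chain is encoded injectively by its two projections, which are
  \<open>L\<close>-subsets of \<open>V\<close>.\<close>

lemma card_chain2_le: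
  assumes "finite V"
  shows "card {P. P \<subseteq> V \<times> V \<and> chain2 P \<and> card P = L} \<le> (card V choose L)\<^sup>2"
proof -
  let ?C = "{P. P \<subseteq> V \<times> V \<and> chain2 P \<and> card P = L}" and ?S = "{A. A \<subseteq> V \<and> card A = L}"
  have fin: "finite P" if "P \<subseteq> V \<times> V" for P
    using that assms finite_subset finite_cartesian_product by blast
  have "card ?C \<le> card (?S \<times> ?S)"
  proof (rule card_inj_on_le[of "\<lambda>P. (fst ` P, snd ` P)"])
    show "inj_on (\<lambda>P. (fst ` P, snd ` P)) ?C"
    proof (rule inj_onI)
      fix P P' assume *: "P \<in> ?C" "P' \<in> ?C" "(fst ` P, snd ` P) = (fst ` P', snd ` P')"
      show "P = P'"
        using chain2_subset_of_projections[of P P'] chain2_subset_of_projections[of P' P] * fin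
        by auto
    qed
    show "(\<lambda>P. (fst ` P, snd ` P)) ` ?C \<subseteq> ?S \<times> ?S"
    proof (rule image_subsetI)
      fix P assume P: "P \<in> ?C"
      hence "fst ` P \<subseteq> V" "snd ` P \<subseteq> V" by auto
      moreover have "card (fst ` P) = L" "card (snd ` P) = L"
        using chain2_inj[of P] P by (auto simp: card_image)
      ultimately show "(fst ` P, snd ` P) \<in> ?S \<times> ?S" by simp
    qed
    show "finite (?S \<times> ?S)" using assms by simp
  qed
  also have "\<dots> = (card V choose L)\<^sup>2"
    using assms by (simp add: n_subsets card_cartesian_product power2_eq_square)
  finally show ?thesis .
qed

section \<open>Counting the patterns that have a long chain\<close>

lemma finite_Sym [simp]: "finite (Sym k)"
  by (simp add: Sym_def finite_permutations)

lemma card_Sym: "card (Sym k) = fact k"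
  by (simp add: Sym_def card_permutations)

text \<open>Permuting the values on the first coordinates of \<open>P\<close> loses no information: the constraints
  determine the value at such a position from a smaller value, hence eventually from the values
  at the other positions.\<close>

lemma card_Sym_constrained:
  assumes P: "P \<subseteq> {1..k} \<times> {1..k}" "inj_on fst P" and d: "d > 0"
  shows "card {\<pi>\<in>Sym k. \<forall>p\<in>P. \<pi> (fst p) = \<pi> (snd p) + d} * fact (card P) \<le> fact k"
proof -
  let ?X = "{\<pi>\<in>Sym k. \<forall>p\<in>P. \<pi> (fst p) = \<pi> (snd p) + d}" and ?A = "fst ` P"
  let ?Y = "{\<tau>. \<tau> permutes ?A}"
  have finP: "finite P" using P finite_subset by blast
  have A: "?A \<subseteq> {1..k}" using P by auto
  have "card (?X \<times> ?Y) \<le> card (Sym k)"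
  proof (rule card_inj_on_le[of "\<lambda>(\<pi>, \<tau>). \<pi> \<circ> \<tau>"])
    show "inj_on (\<lambda>(\<pi>, \<tau>). \<pi> \<circ> \<tau>) (?X \<times> ?Y)"
    proof (rule inj_onI, clarify)
      fix \<pi> \<tau> \<pi>' \<tau>'
      assume X: "\<pi> \<in> Sym k" "\<forall>p\<in>P. \<pi> (fst p) = \<pi> (snd p) + d"
        "\<pi>' \<in> Sym k" "\<forall>p\<in>P. \<pi>' (fst p) = \<pi>' (snd p) + d"
        and Y: "\<tau> permutes ?A" "\<tau>' permutes ?A" and eq: "\<pi> \<circ> \<tau> = \<pi>' \<circ> \<tau>'"
      have "\<pi> a = \<pi>' a" for a
      proof (induction "\<pi> a" arbitrary: a rule: less_induct)
        case less
        show ?case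
        proof (cases "a \<in> ?A")
          case False
          thus ?thesis using fun_cong[OF eq, of a] Y by (simp add: permutes_not_in)
        next
          case True
          then obtain p where p: "p \<in> P" "a = fst p" by auto
          thus ?thesis using less[of "snd p"] X d by auto
        qed
      qed
      hence "\<pi> = \<pi>'" by blast
      moreover have "inj \<pi>" using X by (auto simp: Sym_def intro: permutes_inj)
      ultimately show "\<pi> = \<pi>' \<and> \<tau> = \<tau>'" using eq by (simp add: fun.inj_map_strong fun_eq_iff) (metis injD)
    qed
    show "(\<lambda>(\<pi>, \<tau>). \<pi> \<circ> \<tau>) ` (?X \<times> ?Y) \<subseteq> Sym k"
      using permutes_subset[OF _ A] by (auto simp: Sym_def intro: permutes_compose)
  qed simp
  moreover have "card ?Y = fact (card P)"
    using P finP by (simp add: card_permutations card_image)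
  ultimately show ?thesis by (simp add: card_cartesian_product card_Sym)
qed

text \<open>The largest chain for a fixed \<open>d\<close> has size \<open>L_d(\<pi>)\<close>. Here
  \<open>d\<close> stands for the difference of two shifts below \<open>T\<close>, hence its
  range.\<close>

definition chain_bounded :: "nat \<Rightarrow> nat \<Rightarrow> nat \<Rightarrow> (nat \<Rightarrow> nat) set" where
  "chain_bounded k T L = {\<pi>\<in>Sym k. \<forall>d\<in>{1..<T}. \<forall>P. P \<subseteq> {1..k} \<times> {1..k} \<longrightarrow> chain2 P \<longrightarrow>
     (\<forall>p\<in>P. \<pi> (fst p) = \<pi> (snd p) + d) \<longrightarrow> card P \<le> L}"

text \<open>Union bound over \<open>d\<close> and over chains cut down to exactly \<open>L\<close>
  pairs: there are at most \<open>(k choose L)^2\<close> chains, and each constrains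
  \<open>\<pi>\<close> to a fraction of at most \<open>1 / fact L\<close>. The other two factors
  \<open>fact L\<close> turn the binomials into powers of \<open>k\<close>.\<close>

lemma card_not_chain_bounded:
  "card (Sym k - chain_bounded k T L) * fact L ^ 3 \<le> T * k ^ (2 * L) * fact k"
proof -
  let ?X = "\<lambda>d P. {\<pi>\<in>Sym k. \<forall>p\<in>P. \<pi> (fst p) = \<pi> (snd p) + d}"
  let ?C = "{P. P \<subseteq> {1..k} \<times> {1..k} \<and> chain2 P \<and> card P = L}"
  have finC: "finite ?C" by (rule finite_subset[of _ "Pow ({1..k} \<times> {1..k})"]) auto
  have "Sym k - chain_bounded k T L \<subseteq> (\<Union>(d, P)\<in>{1..<T} \<times> ?C. ?X d P)"
  proof
    fix \<pi> assume "\<pi> \<in> Sym k - chain_bounded k T L"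
    then obtain d P where *: "\<pi> \<in> Sym k" "d \<in> {1..<T}" "P \<subseteq> {1..k} \<times> {1..k}" "chain2 P"
       "\<forall>p\<in>P. \<pi> (fst p) = \<pi> (snd p) + d" "\<not> card P \<le> L"
      by (auto simp: chain_bounded_def)
    then obtain P' where P': "P' \<subseteq> P" "card P' = L"
      by (meson linear obtain_subset_with_card_n)
    have "P' \<in> ?C" using * P' chain2_subset[of P P'] by auto
    moreover have "\<pi> \<in> ?X d P'" using * P' by auto
    ultimately show "\<pi> \<in> (\<Union>(d, P)\<in>{1..<T} \<times> ?C. ?X d P)" using *(2) by blast
  qed
  hence "card (Sym k - chain_bounded k T L) \<le> card (\<Union>(d, P)\<in>{1..<T} \<times> ?C. ?X d P)"
    using finC by (intro card_mono) auto
  also have "\<dots> \<le> (\<Sum>(d, P)\<in>{1..<T} \<times> ?C. card (?X d P))"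
    using card_UN_le[of "{1..<T} \<times> ?C" "\<lambda>(d, P). ?X d P"] finC by (simp add: case_prod_unfold)
  finally have "card (Sym k - chain_bounded k T L) * fact L
      \<le> (\<Sum>(d, P)\<in>{1..<T} \<times> ?C. card (?X d P)) * fact L"
    by simp
  also have "\<dots> = (\<Sum>(d, P)\<in>{1..<T} \<times> ?C. card (?X d P) * fact L)"
    by (simp add: sum_distrib_right case_prod_unfold)
  also have "\<dots> \<le> (\<Sum>(d, P)\<in>{1..<T} \<times> ?C. fact k)"
  proof (rule sum_mono, clarify)
    fix d P assume "d \<in> {1..<T}" "P \<subseteq> {1..k} \<times> {1..k}" "chain2 P" "L = card P"
    thus "card (?X d P) * fact (card P) \<le> fact k"
      using chain2_inj by (intro card_Sym_constrained) auto
  qed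
  also have "\<dots> \<le> T * (k choose L)\<^sup>2 * fact k"
    using card_chain2_le[of "{1..k}" L] by (auto simp: card_cartesian_product intro!: mult_mono)
  finally have "card (Sym k - chain_bounded k T L) * fact L * (fact L)\<^sup>2
     \<le> T * (k choose L)\<^sup>2 * fact k * (fact L)\<^sup>2" by simp
  also have "\<dots> = T * ((k choose L) * fact L)\<^sup>2 * fact k"
    by (simp add: power_mult_distrib)
  also have "\<dots> \<le> T * (k ^ L)\<^sup>2 * fact k"
    using binomial_fact_pow by (intro mult_mono power_mono) auto
  finally show ?thesis by (simp add: power2_eq_square power3_eq_cube mult.assoc mult_2 power_add)
qed

section \<open>Elementary factorial bounds of Stirling type\<close>

lemma power_self_le_exp_fact: "real n ^ n \<le> exp n * fact n"
proof (induction n)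
  case (Suc n)
  show ?case
  proof (cases "n = 0")
    case False
    have "real (Suc n) ^ n = real n ^ n * (1 + 1 / n) ^ n"
      using False by (simp add: field_simps flip: power_mult_distrib)
    also have "\<dots> \<le> (exp n * fact n) * exp (1 / n) ^ n"
      by (intro mult_mono power_mono exp_ge_add_one_self Suc.IH) auto
    also have "exp (1 / real n) ^ n = exp 1"
      using False by (simp flip: exp_of_nat_mult)
    also have "exp n * fact n * exp 1 = exp (Suc n) * (fact n :: real)"
      by (simp add: exp_add)
    finally show ?thesis by (simp add: mult_ac del: of_nat_Suc)
  qed (use exp_ge_add_one_self[of 1] in auto)
qed simp

text \<open>The induction rests on \<open>(n/(n+1))^(n+1) \<le> 1/e\<close>, the counterpart of
  \<open>(1+1/n)^n \<le> e\<close> in the lower bound. Both bounds together locate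
  \<open>fact n\<close> up to the factor \<open>exp 1 * n\<close>.\<close>

lemma exp_fact_le: "n > 0 \<Longrightarrow> exp n * fact n \<le> exp 1 * real n * real n ^ n"
proof (induction n rule: nat_induct_non_zero)
  case (Suc n)
  have "exp (1 :: real) * real n ^ Suc n \<le> real (Suc n) ^ Suc n"
  proof -
    have "(real n / Suc n) ^ Suc n \<le> exp (- 1 / Suc n) ^ Suc n"
      using exp_ge_add_one_self[of "- 1 / Suc n"] by (intro power_mono) (auto simp: field_simps)
    also have "\<dots> = exp (- 1)" by (simp flip: exp_of_nat_mult del: power_Suc)
    finally show ?thesis by (simp add: power_divide exp_minus divide_simps del: power_Suc of_nat_Suc) (simp add: mult_ac)
  qed
  hence *: "exp (1 :: real) * (exp 1 * real n ^ Suc n) * Suc n \<le> exp 1 * real (Suc n) ^ Suc n * Suc n"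
    by (intro mult_right_mono mult_left_mono) auto
  have "exp (Suc n) * fact (Suc n) = (exp n * fact n) * exp 1 * Suc n"
    by (simp add: exp_add)
  also have "\<dots> \<le> (exp 1 * real n * real n ^ n) * exp 1 * Suc n"
    using Suc.IH by (intro mult_right_mono) auto
  also have "\<dots> \<le> exp 1 * real (Suc n) ^ Suc n * Suc n"
    using * by (simp add: mult_ac del: of_nat_Suc)
  finally show ?case by (simp add: mult_ac del: of_nat_Suc)
qed simp

section \<open>Random permutations and block sequences\<close>

definition block :: "nat \<Rightarrow> nat \<Rightarrow> nat" where
  "block m v = (v - 1) div m"

lemma block_eq_interval:
  assumes "m > 0" "r < R"
  shows "{v\<in>{1..m * R}. block m v = r} = {r * m + 1..r * m + m}"
proof (intro equalityI subsetI)
  fix v assume "v \<in> {v\<in>{1..m * R}. block m v = r}"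
  then obtain u where u: "v = Suc u" "u div m = r" by (cases v) (auto simp: block_def)
  have "u = r * m + u mod m" using u(2) by auto
  moreover have "u mod m < m" using assms by simp
  ultimately show "v \<in> {r * m + 1..r * m + m}" using u(1) by simp
next
  fix v assume v: "v \<in> {r * m + 1..r * m + m}"
  hence "(v - 1) div m = r" by (intro div_nat_eqI) (auto simp: mult.commute)
  moreover have "r * m + m \<le> m * R"
    using mult_le_mono2[of "Suc r" R m] assms by (simp add: mult.commute)
  ultimately show "v \<in> {v\<in>{1..m * R}. block m v = r}" using v by (auto simp: block_def)
qed

lemma block_less:
  assumes "m > 0" "v \<in> {1..m * R}"
  shows "block m v < R"
  using assms by (auto simp: block_def less_mult_imp_div_less mult.commute)

text \<open>Each of the \<open>R\<close> blocks has \<open>m\<close> values, so a given word of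
  blocks lifts to at most \<open>fact m ^ R\<close> permutations.\<close>

lemma card_permutations_with_blocks:
  assumes m: "m > 0" and F: "finite F"
  shows "card {xs\<in>permutations_of_set {1..m * R}. map (block m) xs \<in> F} \<le> card F * fact m ^ R"
proof -
  let ?G = "\<lambda>ys. {xs. distinct xs \<and> set xs \<subseteq> {1..m * R} \<and> map (block m) xs = ys}"
  have fin: "finite (?G ys)" for ys
    by (rule finite_subset[OF _ finite_subset_distinct[of "{1..m * R}"]]) auto
  have "card {xs\<in>permutations_of_set {1..m * R}. map (block m) xs \<in> F} \<le> card (\<Union>ys\<in>F. ?G ys)"
    using F fin by (intro card_mono) (auto simp: permutations_of_set_def)
  also have "\<dots> \<le> (\<Sum>ys\<in>F. card (?G ys))" using F by (rule card_UN_le)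
  also have "\<dots> \<le> (\<Sum>ys\<in>F. fact m ^ R)"
  proof (rule sum_mono)
    fix ys
    have "card (?G ys) \<le> (\<Prod>r<R. fact (card {v\<in>{1..m * R}. block m v = r}))"
      using block_less[OF m] by (intro card_distinct_lists_with_colours) auto
    also have "\<dots> = (\<Prod>r<R. fact m)"
      using m by (intro prod.cong refl) (simp only: block_eq_interval lessThan_iff, simp)
    finally show "card (?G ys) \<le> fact m ^ R" by simp
  qed
  finally show ?thesis by simp
qed

text \<open>The price of passing from uniform words of blocks to uniform permutations. With
  \<open>m = 10k\<close> and \<open>R = 2k\<close> it is only
  \<open>exp (O(k ln k))\<close>.\<close>

lemma fact_power_ratio:
  assumes "m > 0" "R > 0"
  shows "real R ^ (m * R) * fact m ^ R \<le> (exp 1 * m) ^ R * fact (m * R)"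
proof -
  let ?n = "m * R"
  have "(exp (real m) * fact m) ^ R \<le> (exp 1 * real m * real m ^ m) ^ R"
    using exp_fact_le[OF assms(1)] by (intro power_mono) auto
  hence "exp (real ?n) * fact m ^ R \<le> (exp 1 * m) ^ R * real m ^ ?n"
    by (simp add: power_mult_distrib mult.commute[of "real m" "real R"] exp_of_nat_mult flip: power_mult)
  hence "real R ^ ?n * (exp (real ?n) * fact m ^ R) \<le> real R ^ ?n * ((exp 1 * m) ^ R * real m ^ ?n)"
    by (intro mult_left_mono) auto
  also have "\<dots> = (exp 1 * m) ^ R * real ?n ^ ?n"
    by (simp add: power_mult_distrib)
  also have "\<dots> \<le> (exp 1 * m) ^ R * (exp (real ?n) * fact ?n)"
    by (intro mult_left_mono power_self_le_exp_fact) auto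
  finally have "exp (real ?n) * (real R ^ ?n * fact m ^ R) \<le> exp (real ?n) * ((exp 1 * m) ^ R * fact ?n)"
    by (simp only: mult_ac)
  thus ?thesis by simp
qed

section \<open>Permutations as words in one-line notation\<close>

definition one_line :: "nat \<Rightarrow> (nat \<Rightarrow> nat) \<Rightarrow> nat list" where
  "one_line n \<sigma> = map \<sigma> [1..<Suc n]"

lemma length_one_line [simp]: "length (one_line n \<sigma>) = n"
  by (simp add: one_line_def)

lemma nth_one_line: "i < n \<Longrightarrow> one_line n \<sigma> ! i = \<sigma> (Suc i)"
  by (simp add: one_line_def nth_append del: upt_Suc)

lemma one_line_in_permutations:
  assumes "\<sigma> \<in> Sym n"
  shows "one_line n \<sigma> \<in> permutations_of_set {1..n}"
proof -
  have s: "\<sigma> permutes {1..n}" using assms by (simp add: Sym_def)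
  have I: "{Suc 0..<Suc n} = {1..n}" by auto
  have "inj_on \<sigma> {1..n}" using permutes_inj[OF s] by (rule inj_on_subset) simp
  thus ?thesis using permutes_image[OF s] I
    by (simp add: one_line_def permutations_of_set_def distinct_map del: upt_Suc)
qed

lemma card_Sym_one_line_le:
  "card {\<sigma>\<in>Sym n. P (one_line n \<sigma>)} \<le> card {xs\<in>permutations_of_set {1..n}. P xs}"
proof (rule card_inj_on_le[of "one_line n"])
  show "inj_on (one_line n) {\<sigma>\<in>Sym n. P (one_line n \<sigma>)}"
  proof (rule inj_onI)
    fix \<sigma> \<tau> assume *: "\<sigma> \<in> {\<sigma>\<in>Sym n. P (one_line n \<sigma>)}" "\<tau> \<in> {\<sigma>\<in>Sym n. P (one_line n \<sigma>)}" "one_line n \<sigma> = one_line n \<tau>"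
    have "\<sigma> i = \<tau> i" for i
    proof (cases "i \<in> {1..n}")
      case True
      hence "i - 1 < n" "Suc (i - 1) = i" by auto
      thus ?thesis using nth_one_line[of "i - 1" n \<sigma>] nth_one_line[of "i - 1" n \<tau>] *(3) by simp
    next
      case False
      thus ?thesis using * by (auto simp: Sym_def permutes_not_in)
    qed
    thus "\<sigma> = \<tau>" by blast
  qed
qed (use one_line_in_permutations in simp_all, blast)

text \<open>The entries found lie in distinct blocks that are ordered like the values of
  \<open>\<pi>\<close>, since the shift \<open>j\<close> preserves this order; a later block holds
  larger values.\<close>

lemma contains_pattern_if_scan:
  assumes \<pi>: "\<pi> \<in> Sym k" and scan: "scan (\<lambda>p. \<pi> (Suc p) - 1 + j) (map (block m) (one_line n \<sigma>)) \<ge> k"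
  shows "contains_pattern n \<sigma> k \<pi>"
proof -
  let ?w = "\<lambda>p. \<pi> (Suc p) - 1 + j" and ?ys = "map (block m) (one_line n \<sigma>)"
  obtain x where mono: "strict_mono_on {1..scan ?w ?ys} x"
    and x: "\<And>i. i\<in>{1..scan ?w ?ys} \<Longrightarrow> x i \<in> {1..n} \<and> ?ys ! (x i - 1) = ?w (i - 1)"
    using scan_embedding[of ?w ?ys] by auto
  have xk: "x i \<in> {1..n} \<and> block m (\<sigma> (x i)) = \<pi> i - 1 + j" if "i \<in> {1..k}" for i
  proof -
    have "i \<in> {1..scan ?w ?ys}" using that scan by simp
    from x[OF this] have *: "x i \<in> {1..n}" "?ys ! (x i - 1) = ?w (i - 1)" by auto
    hence "x i - 1 < n" "Suc (x i - 1) = x i" "Suc (i - 1) = i" using that by auto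
    with * show ?thesis by (simp add: nth_one_line)
  qed
  have less: "\<sigma> (x a) < \<sigma> (x b)" if "a \<in> {1..k}" "b \<in> {1..k}" "\<pi> a < \<pi> b" for a b
  proof -
    have "\<pi> a \<in> {1..k}" using \<pi> that(1) permutes_in_image[of \<pi> "{1..k}" a] by (simp add: Sym_def)
    hence "block m (\<sigma> (x a)) < block m (\<sigma> (x b))" using xk[OF that(1)] xk[OF that(2)] that(3) by auto
    thus ?thesis unfolding block_def by (metis div_le_mono diff_le_mono not_le)
  qed
  have "inj \<pi>" using \<pi> by (auto simp: Sym_def intro: permutes_inj)
  hence "\<sigma> (x a) < \<sigma> (x b) \<longleftrightarrow> \<pi> a < \<pi> b" if "a \<in> {1..k}" "b \<in> {1..k}" for a b
    using less[of a b] less[of b a] that by (metis injD linorder_neqE_nat not_less_iff_gr_or_eq)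
  moreover have "strict_mono_on {1..k} x"
    using mono scan by (auto simp: strict_mono_on_def)
  ultimately show ?thesis unfolding contains_pattern_def using xk by blast
qed

text \<open>Union bound over the start of the window and the missed block, whose values have density
  \<open>1 / R\<close>.\<close>

lemma card_not_windows_full:
  assumes m: "m > 0" and R: "R > 0"
  shows "real (card {\<sigma>\<in>Sym (m * R). \<not> windows_full R W (map (block m) (one_line (m * R) \<sigma>))})
     \<le> real ((m * R + 1) * R) * (1 - 1 / R) ^ W * fact (m * R)"
proof -
  let ?n = "m * R"
  let ?S = "\<lambda>r. {v\<in>{1..?n}. block m v = r}"
  let ?A = "\<lambda>s r. {xs\<in>permutations_of_set {1..?n}. set (take W (drop s xs)) \<inter> ?S r = {}}"
  let ?I = "{s. s + W \<le> ?n} \<times> {..<R}"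
  have finI: "finite ?I" by (rule finite_subset[of _ "{..?n} \<times> {..<R}"]) auto
  have "card ?I \<le> card ({..?n} \<times> {..<R})" by (intro card_mono) auto
  hence cI: "card ?I \<le> (?n + 1) * R" by (simp add: card_cartesian_product)
  have "card {\<sigma>\<in>Sym ?n. \<not> windows_full R W (map (block m) (one_line ?n \<sigma>))}
      \<le> card {xs\<in>permutations_of_set {1..?n}. \<not> windows_full R W (map (block m) xs)}"
    by (rule card_Sym_one_line_le)
  also have "\<dots> \<le> card (\<Union>(s, r)\<in>?I. ?A s r)"
  proof (rule card_mono)
    show "{xs\<in>permutations_of_set {1..?n}. \<not> windows_full R W (map (block m) xs)} \<subseteq> (\<Union>(s, r)\<in>?I. ?A s r)"
    proof
      fix xs assume "xs \<in> {xs\<in>permutations_of_set {1..?n}. \<not> windows_full R W (map (block m) xs)}"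
      hence xs: "xs \<in> permutations_of_set {1..?n}" and nf: "\<not> windows_full R W (map (block m) xs)" by auto
      have "length xs = ?n" using length_finite_permutations_of_set[OF xs] by simp
      then obtain s r where sr: "(s, r) \<in> ?I" "r \<notin> set (take W (drop s (map (block m) xs)))"
        using nf by (auto simp: windows_full_def)
      hence "xs \<in> ?A s r" using xs by (auto simp: take_map drop_map)
      with sr(1) show "xs \<in> (\<Union>(s, r)\<in>?I. ?A s r)" by blast
    qed
  qed (use finI in auto)
  also have "\<dots> \<le> (\<Sum>(s, r)\<in>?I. card (?A s r))"
    using card_UN_le[OF finI, of "\<lambda>(s, r). ?A s r"] by (simp add: case_prod_unfold)
  finally have "real (card {\<sigma>\<in>Sym ?n. \<not> windows_full R W (map (block m) (one_line ?n \<sigma>))})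
      \<le> real (\<Sum>(s, r)\<in>?I. card (?A s r))" by (simp only: of_nat_le_iff)
  also have "\<dots> = (\<Sum>(s, r)\<in>?I. real (card (?A s r)))" by (simp add: case_prod_unfold)
  also have "\<dots> \<le> (\<Sum>(s, r)\<in>?I. (1 - 1 / R) ^ W * fact ?n)"
  proof (rule sum_mono, clarify)
    fix s r assume sr: "s + W \<le> ?n" "r < R"
    have S: "?S r = {r * m + 1..r * m + m}" using block_eq_interval[of m r R] m sr by simp
    hence c: "card (?S r) = m" "?S r \<noteq> {}" using m by auto
    have "real (card (?A s r)) \<le> (1 - card (?S r) / card {1..?n}) ^ W * fact (card {1..?n})"
      using sr c by (intro card_permutations_avoiding_window) auto
    also have "\<dots> = (1 - 1 / R) ^ W * fact ?n"
      using m by (simp only: c) simp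
    finally show "real (card (?A s r)) \<le> (1 - 1 / R) ^ W * fact ?n" .
  qed
  also have "\<dots> = real (card ?I) * ((1 - 1 / R) ^ W * fact ?n)" by simp
  also have "\<dots> \<le> real ((?n + 1) * R) * ((1 - 1 / R) ^ W * fact ?n)"
    using R cI by (intro mult_right_mono mult_nonneg_nonneg zero_le_power) (simp_all only: of_nat_le_iff, auto)
  finally show ?thesis by (simp only: mult.assoc)
qed

text \<open>Avoiding \<open>\<pi>\<close> makes all \<open>T\<close> scans fail, so the failing
  words are counted first and then lifted to permutations. The condition
  \<open>k + T \<le> Suc R\<close> keeps the highest awaited block,
  \<open>(k - 1) + (T - 1)\<close>, below \<open>R\<close>.\<close>

lemma card_avoiding:
  assumes \<pi>: "\<pi> \<in> chain_bounded k T L" and m: "m > 0" and R: "R > 0" "k + T \<le> Suc R"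
  shows "real (card {\<sigma>\<in>Sym (m * R). windows_full R W (map (block m) (one_line (m * R) \<sigma>)) \<and>
       \<not> contains_pattern (m * R) \<sigma> k \<pi>})
     \<le> (exp 1 * m) ^ R * exp (real k * T - (real T * real (m * R) - real T ^ 2 * L * W) / (2 * real R)) * fact (m * R)"
proof -
  let ?n = "m * R"
  let ?w = "\<lambda>j p. \<pi> (Suc p) - 1 + j"
  let ?e = "(real T * real ?n - real T ^ 2 * L * W) / (2 * real R) - real k * T"
  define F where "F = {ys. length ys = ?n \<and> set ys \<subseteq> {..<R} \<and> windows_full R W ys \<and> (\<forall>j<T. scan (?w j) ys < k)}"
  have Sym: "\<pi> \<in> Sym k" using \<pi> by (simp add: chain_bounded_def)
  have rng: "\<pi> (Suc p) \<in> {1..k}" if "p < k" for p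
    using Sym permutes_in_image[of \<pi> "{1..k}" "Suc p"] that by (auto simp: Sym_def)
  have finF: "finite F"
    by (rule finite_subset[OF _ finite_lists_length_eq[of "{..<R}" ?n]]) (auto simp: F_def)
  have cF: "card F * exp ?e \<le> real R ^ ?n"
    unfolding F_def
  proof (rule card_all_scans_fail)
    fix j p assume "j < T" "p < k"
    thus "?w j p < R" using rng[of p] R by auto
  next
    fix i j P assume ij: "i < j" "j < T" and P: "P \<subseteq> {..<k} \<times> {..<k}" "chain2 P"
      and eq: "\<forall>p\<in>P. ?w i (fst p) = ?w j (snd p)"
    let ?P = "map_prod Suc Suc ` P"
    have "card ?P \<le> L"
    proof -
      \<comment> \<open>Scans with shifts \<open>i < j\<close> that await the same block see values
        of \<open>\<pi>\<close> differing by \<open>j - i\<close>; \<open>Suc\<close> translates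
        scan states into positions of \<open>\<pi>\<close>.\<close>
      have "\<pi> (fst p) = \<pi> (snd p) + (j - i)" if "p \<in> ?P" for p
      proof -
        obtain q where q: "q \<in> P" "p = map_prod Suc Suc q" using \<open>p \<in> ?P\<close> by auto
        hence "fst q < k" "snd q < k" using P by auto
        from rng[OF this(1)] rng[OF this(2)] show ?thesis
          using bspec[OF eq q(1)] ij q(2) by auto
      qed
      moreover have "?P \<subseteq> {1..k} \<times> {1..k}" using P(1) by (force simp: subset_iff Suc_le_eq)
      moreover have "chain2 ?P" using P by (auto simp: chain2_def)
      moreover have "j - i \<in> {1..<T}" using ij by auto
      ultimately show ?thesis using \<pi> unfolding chain_bounded_def by blast
    qed
    moreover have "card ?P = card P" by (intro card_image) (auto simp: inj_on_def)
    ultimately show "card P \<le> L" by simp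
  qed
  have "{\<sigma>\<in>Sym ?n. windows_full R W (map (block m) (one_line ?n \<sigma>)) \<and> \<not> contains_pattern ?n \<sigma> k \<pi>}
     \<subseteq> {\<sigma>\<in>Sym ?n. map (block m) (one_line ?n \<sigma>) \<in> F}"
  proof clarify
    fix \<sigma> assume \<sigma>: "\<sigma> \<in> Sym ?n" and full: "windows_full R W (map (block m) (one_line ?n \<sigma>))"
      and avoid: "\<not> contains_pattern ?n \<sigma> k \<pi>"
    have "set (one_line ?n \<sigma>) = {1..?n}"
      using one_line_in_permutations[OF \<sigma>] by (simp add: permutations_of_set_def)
    hence "set (map (block m) (one_line ?n \<sigma>)) \<subseteq> {..<R}" using block_less[OF m] by auto
    moreover have "scan (?w j) (map (block m) (one_line ?n \<sigma>)) < k" for j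
      using contains_pattern_if_scan[OF Sym] avoid by (meson not_le)
    ultimately show "map (block m) (one_line ?n \<sigma>) \<in> F" using full by (simp add: F_def)
  qed
  hence "card {\<sigma>\<in>Sym ?n. windows_full R W (map (block m) (one_line ?n \<sigma>)) \<and> \<not> contains_pattern ?n \<sigma> k \<pi>}
     \<le> card {\<sigma>\<in>Sym ?n. map (block m) (one_line ?n \<sigma>) \<in> F}"
    by (intro card_mono) auto
  also have "\<dots> \<le> card {xs\<in>permutations_of_set {1..?n}. map (block m) xs \<in> F}"
    by (rule card_Sym_one_line_le)
  also have "\<dots> \<le> card F * fact m ^ R"
    by (rule card_permutations_with_blocks[OF m finF])
  finally have "real (card {\<sigma>\<in>Sym ?n. windows_full R W (map (block m) (one_line ?n \<sigma>)) \<and> \<not> contains_pattern ?n \<sigma> k \<pi>})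
     \<le> real (card F * fact m ^ R)" by (simp only: of_nat_le_iff)
  also have "\<dots> = real (card F) * fact m ^ R" by simp
  also have "\<dots> = (card F * exp ?e) * exp (- ?e) * fact m ^ R"
    by (simp only: mult.assoc[of "real (card F)"] exp_minus_inverse mult_1_left mult_1_right)
  also have "\<dots> \<le> real R ^ ?n * exp (- ?e) * fact m ^ R"
    by (intro mult_right_mono cF) auto
  also have "\<dots> = exp (- ?e) * (real R ^ ?n * fact m ^ R)" by simp
  also have "\<dots> \<le> exp (- ?e) * ((exp 1 * m) ^ R * fact ?n)"
    by (intro mult_left_mono fact_power_ratio m R) auto
  finally show ?thesis by (simp add: mult_ac)
qed

section \<open>Asymptotics\<close>

text \<open>The first term covers the permutations with a defective window, once for all patterns;
  the second is the union bound over at most \<open>fact k\<close> patterns for the others.\<close>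

lemma prob_not_universal:
  fixes k T L W :: nat
  defines "n \<equiv> 20 * k\<^sup>2"
  assumes k: "k > 0" and T: "T \<le> k" and TLW: "T * L * W \<le> 4 * k\<^sup>2"
  shows "measure_pmf.prob (pmf_of_set (Sym n)) {\<sigma>. \<not> (\<forall>\<pi>\<in>chain_bounded k T L. contains_pattern n \<sigma> k \<pi>)}
    \<le> real ((n + 1) * (2 * k)) * (1 - 1 / (2 * k)) ^ W
      + fact k * ((exp 1 * (10 * k)) ^ (2 * k) * exp (- 3 * real k * T))"
proof -
  let ?m = "10 * k" and ?R = "2 * k"
  have n: "n = ?m * ?R" by (simp add: n_def power2_eq_square)
  let ?Q = "chain_bounded k T L"
  let ?full = "\<lambda>\<sigma>. windows_full ?R W (map (block ?m) (one_line n \<sigma>))"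
  let ?N = "{\<sigma>\<in>Sym n. \<not> ?full \<sigma>}"
  let ?B = "\<lambda>\<pi>. {\<sigma>\<in>Sym n. ?full \<sigma> \<and> \<not> contains_pattern n \<sigma> k \<pi>}"
  let ?b = "(exp 1 * (10 * real k)) ^ (2 * k) * exp (- 3 * real k * T)"
  have Q: "?Q \<subseteq> Sym k" by (auto simp: chain_bounded_def)
  have finQ: "finite ?Q" by (rule finite_subset[OF Q]) simp
  have cQ: "card ?Q \<le> fact k" using card_mono[OF _ Q] by (simp add: card_Sym)
  have ne: "Sym n \<noteq> {}" using card_Sym[of n] by (metis card.empty fact_nonzero)
  have "card (Sym n \<inter> {\<sigma>. \<not> (\<forall>\<pi>\<in>?Q. contains_pattern n \<sigma> k \<pi>)}) \<le> card (?N \<union> (\<Union>\<pi>\<in>?Q. ?B \<pi>))"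
    using finQ by (intro card_mono) auto
  also have "\<dots> \<le> card ?N + card (\<Union>\<pi>\<in>?Q. ?B \<pi>)" by (rule card_Un_le)
  also have "\<dots> \<le> card ?N + (\<Sum>\<pi>\<in>?Q. card (?B \<pi>))"
    using card_UN_le[OF finQ] by (rule add_left_mono)
  finally have "real (card (Sym n \<inter> {\<sigma>. \<not> (\<forall>\<pi>\<in>?Q. contains_pattern n \<sigma> k \<pi>)}))
     \<le> real (card ?N + (\<Sum>\<pi>\<in>?Q. card (?B \<pi>)))" by (simp only: of_nat_le_iff)
  also have "\<dots> = real (card ?N) + (\<Sum>\<pi>\<in>?Q. real (card (?B \<pi>)))" by simp
  also have "\<dots> \<le> real ((n + 1) * ?R) * (1 - 1 / ?R) ^ W * fact n + (\<Sum>\<pi>\<in>?Q. ?b * fact n)"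
  proof (intro add_mono sum_mono)
    show "real (card ?N) \<le> real ((n + 1) * ?R) * (1 - 1 / ?R) ^ W * fact n"
      unfolding n using k by (intro card_not_windows_full) auto
  next
    fix \<pi> assume \<pi>: "\<pi> \<in> ?Q"
    have "real (T * L * W) \<le> real (4 * k\<^sup>2)" using TLW by (simp only: of_nat_le_iff)
    hence "real T * (real T * L * W) \<le> real T * (4 * k\<^sup>2)" by (intro mult_left_mono) auto
    \<comment> \<open>With \<open>n = 20k^2\<close> and \<open>2R = 4k\<close> the waiting term is
      \<open>5kT\<close>. The hits cost \<open>kT\<close>, and by \<open>TLW \<le> 4k^2\<close> the
      coincidences cost at most another \<open>kT\<close>.\<close>
    hence "real k * T - (real T * n - real T ^ 2 * L * W) / (2 * real ?R) \<le> - 3 * real k * T"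
      using k by (simp add: n_def field_simps power2_eq_square)
    moreover have "real (card (?B \<pi>)) \<le> (exp 1 * real ?m) ^ ?R *
        exp (real k * T - (real T * n - real T ^ 2 * L * W) / (2 * real ?R)) * fact n"
      unfolding n using k T \<pi> by (intro card_avoiding) auto
    hence "real (card (?B \<pi>)) \<le> (exp 1 * (10 * real k)) ^ ?R *
        exp (real k * T - (real T * n - real T ^ 2 * L * W) / (2 * real ?R)) * fact n"
      by simp
    ultimately show "real (card (?B \<pi>)) \<le> ?b * fact n"
      by (elim order_trans) (intro mult_right_mono mult_left_mono; simp)
  qed
  also have "(\<Sum>\<pi>\<in>?Q. ?b * fact n) = card ?Q * (?b * fact n)" by simp
  also have "\<dots> \<le> fact k * (?b * fact n)"
  proof (rule mult_right_mono)
    have "real (card ?Q) \<le> real (fact k)" using cQ by (simp only: of_nat_le_iff)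
    thus "real (card ?Q) \<le> fact k" by simp
  qed simp
  finally have *: "real (card (Sym n \<inter> {\<sigma>. \<not> (\<forall>\<pi>\<in>?Q. contains_pattern n \<sigma> k \<pi>)}))
     \<le> (real ((n + 1) * ?R) * (1 - 1 / ?R) ^ W + fact k * ?b) * fact n"
    by (simp only: distrib_right mult.assoc)
  show ?thesis
    using * by (simp add: measure_pmf_of_set[OF ne] card_Sym pos_divide_le_eq)
qed

lemma fact_le_exp: "k > 0 \<Longrightarrow> fact k \<le> exp (real k * ln k)"
  using fact_le_power[of k, where 'a = real] by (simp add: exp_of_nat_mult)

text \<open>Any exponents would do for which the product of the three parameters is \<open>o(k\<^sup>2)\<close>, with
  \<open>shifts k\<close> beyond \<open>ln k\<close>, \<open>chain_length k\<close> beyond \<open>k powr (2/3)\<close> and \<open>window k\<close> beyond \<open>k * ln k\<close>.\<close>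

definition shifts :: "nat \<Rightarrow> nat" where "shifts k = nat \<lceil>real k powr (1/16)\<rceil>"
definition chain_length :: "nat \<Rightarrow> nat" where "chain_length k = nat \<lceil>real k powr (3/4)\<rceil>"
definition window :: "nat \<Rightarrow> nat" where "window k = nat \<lceil>real k powr (17/16)\<rceil>"

lemma nat_ceiling_bounds:
  assumes "x \<ge> 1"
  shows "x \<le> real (nat \<lceil>x\<rceil>)" "real (nat \<lceil>x\<rceil>) \<le> 2 * x"
  using assms by linarith+

lemma parameter_bounds:
  assumes "k > 0"
  shows "real k powr (1/16) \<le> shifts k" "shifts k \<le> 2 * real k powr (1/16)"
    "real k powr (3/4) \<le> chain_length k" "chain_length k \<le> 2 * real k powr (3/4)"
    "real k powr (17/16) \<le> window k" "window k \<le> 2 * real k powr (17/16)"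
  unfolding shifts_def chain_length_def window_def
  using assms by (intro nat_ceiling_bounds ge_one_powr_ge_zero; simp)+

text \<open>Since \<open>L^3\<close> is at least \<open>k^(9/4)\<close>, the ratio
  \<open>k^(2L) / (fact L)^3\<close> is at most \<open>(e^3 / k^(1/4))^L\<close>, which is
  eventually below \<open>exp (- L)\<close> and beats the \<open>T\<close> choices of
  \<open>d\<close>.\<close>

lemma card_chain_bounded_asymp:
  "(\<lambda>k. real (card (chain_bounded k (shifts k) (chain_length k))) / fact k) \<longlonglongrightarrow> 1"
proof (rule tendsto_sandwich)
  let ?g = "\<lambda>k. 1 - 2 * real k powr (1/16) * exp (- (real k powr (3/4)))"
  show "?g \<longlonglongrightarrow> 1" by real_asymp
  \<comment> \<open>Three factors \<open>e\<close> pay for the bound on \<open>(fact L)^3\<close>;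
    the fourth leaves \<open>exp (- L)\<close>.\<close>
  have "eventually (\<lambda>k. exp 4 \<le> real k powr (1/4)) sequentially" by real_asymp
  moreover have "eventually (\<lambda>k. k > 0) sequentially" by (rule eventually_gt_at_top)
  ultimately show "eventually (\<lambda>k. ?g k \<le> real (card (chain_bounded k (shifts k) (chain_length k))) / fact k) sequentially"
  proof eventually_elim
    case (elim k)
    define T where "T = shifts k"
    define L where "L = chain_length k"
    define B where "B = real (card (Sym k - chain_bounded k T L))"
    have L: "real k powr (3/4) \<le> L" and T: "T \<le> 2 * real k powr (1/16)"
      using parameter_bounds[OF elim(2)] by (simp_all add: T_def L_def)
    have "L > 0" using L elim(2) by (cases L) auto
    have "real k ^ 2 * exp 4 \<le> real k ^ 2 * real k powr (1/4)"
      using elim(1) by (intro mult_left_mono) auto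
    also have "real k ^ 2 * real k powr (1/4) = real k powr (2 + 1/4)"
      using elim(2) by (simp only: powr_add) simp
    also have "\<dots> = (real k powr (3/4)) ^ 3"
      using elim(2) by (simp add: powr_power)
    also have "\<dots> \<le> real L ^ 3" using L by (intro power_mono) auto
    finally have "(real k ^ 2 * exp 4) ^ L \<le> (real L ^ 3) ^ L" by (intro power_mono) auto
    also have "\<dots> = (real L ^ L) ^ 3" by (simp add: mult.commute flip: power_mult)
    also have "\<dots> \<le> (exp L * fact L) ^ 3" by (intro power_mono power_self_le_exp_fact) auto
    finally have le: "(real k ^ 2 * exp 4) ^ L \<le> (exp L * fact L) ^ 3" .
    have "exp (4::real) ^ L = exp L * exp (3 * real L)" by (simp flip: exp_of_nat_mult exp_add)
    hence "(real k ^ 2 * exp 4) ^ L = real k ^ (2 * L) * exp L * exp (3 * real L)"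
      by (simp add: power_mult_distrib flip: power_mult)
    moreover have "exp (real L) ^ 3 = exp (3 * real L)" by (simp flip: exp_of_nat_mult)
    hence "(exp L * fact L) ^ 3 = fact L ^ 3 * exp (3 * real L)"
      by (simp add: power_mult_distrib)
    ultimately have kL: "real k ^ (2 * L) * exp L \<le> fact L ^ 3"
      using le by simp
    have "real (card (Sym k - chain_bounded k T L) * fact L ^ 3) \<le> real (T * k ^ (2 * L) * fact k)"
      by (simp only: of_nat_le_iff card_not_chain_bounded)
    hence "B * fact L ^ 3 \<le> T * real k ^ (2 * L) * fact k" by (simp add: B_def)
    hence "B * (real k ^ (2 * L) * exp L) \<le> T * real k ^ (2 * L) * fact k"
      using mult_left_mono[OF kL, of B] by (simp add: B_def)
    hence "real k ^ (2 * L) * (B * exp L) \<le> real k ^ (2 * L) * (real T * fact k)" by (simp only: mult_ac)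
    hence "B * exp L \<le> real T * fact k" using elim(2) by simp
    hence "B / fact k \<le> T * exp (- real L)" by (simp add: exp_minus field_simps)
    also have "\<dots> \<le> 2 * real k powr (1/16) * exp (- (real k powr (3/4)))"
      using L T by (intro mult_mono) auto
    finally have "B / fact k \<le> 2 * real k powr (1/16) * exp (- (real k powr (3/4)))" .
    moreover have "chain_bounded k T L \<subseteq> Sym k" by (auto simp: chain_bounded_def)
    hence "card (Sym k) = card (Sym k - chain_bounded k T L) + card (chain_bounded k T L)"
      by (metis card_Diff_subset card_mono finite_Sym finite_subset le_add_diff_inverse2)
    hence "fact k = B + real (card (chain_bounded k T L))"
      unfolding B_def card_Sym by (metis of_nat_add of_nat_fact)
    hence "real (card (chain_bounded k T L)) = fact k - B" by simp
    hence "real (card (chain_bounded k T L)) / fact k = 1 - B / fact k"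
      by (simp add: diff_divide_distrib)
    ultimately show ?case by (simp add: T_def L_def)
  qed
  have "card (chain_bounded k T L) \<le> fact k" for k T L
    using card_mono[of "Sym k" "chain_bounded k T L"] by (auto simp: chain_bounded_def card_Sym)
  hence "real (card (chain_bounded k T L)) \<le> fact k" for k T L
    by (metis of_nat_fact of_nat_le_iff)
  thus "eventually (\<lambda>k. real (card (chain_bounded k (shifts k) (chain_length k))) / fact k \<le> 1) sequentially"
    by simp
qed simp

text \<open>The window term is a polynomial times \<open>exp (- k^(1/16) / 2)\<close>. In the
  pattern term the exponent is \<open>3 k ln k + O(k) - 3 k k^(1/16)\<close>, so both tend to
  0.\<close>

lemma prob_universal_asymp:
  "(\<lambda>k. measure_pmf.prob (pmf_of_set (Sym (20 * k\<^sup>2)))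
     {\<sigma>. \<forall>\<pi>\<in>chain_bounded k (shifts k) (chain_length k). contains_pattern (20 * k\<^sup>2) \<sigma> k \<pi>}) \<longlonglongrightarrow> 1"
  (is "?P \<longlonglongrightarrow> 1")
proof (rule tendsto_sandwich)
  let ?a = "\<lambda>k. (20 * real k ^ 2 + 1) * (2 * real k) * exp (- (real k powr (1/16)) / 2)"
  let ?b = "\<lambda>k. exp (real k * ln (real k) + 2 * real k * ln (exp 1 * (10 * real k)) - 3 * real k * real k powr (1/16))"
  show "(\<lambda>k. 1 - (?a k + ?b k)) \<longlonglongrightarrow> 1" by real_asymp
  \<comment> \<open>In the second claim the exponents add up to \<open>15/8\<close>, below 2, which
    leaves room for the constants from rounding up.\<close>
  have "eventually (\<lambda>k. 2 * real k powr (1/16) \<le> real k) sequentially"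
       "eventually (\<lambda>k. 2 * real k powr (1/16) * (2 * real k powr (3/4)) * (2 * real k powr (17/16)) \<le> 4 * real k ^ 2) sequentially"
    by real_asymp+
  moreover have "eventually (\<lambda>k. k > 0) sequentially" by (rule eventually_gt_at_top)
  ultimately show "eventually (\<lambda>k. 1 - (?a k + ?b k) \<le> ?P k) sequentially"
  proof eventually_elim
    case (elim k)
    define T where "T = shifts k"
    define L where "L = chain_length k"
    define W where "W = window k"
    define n where "n = 20 * k\<^sup>2"
    note bounds = parameter_bounds[OF elim(3), folded T_def L_def W_def]
    have "real T \<le> k" using bounds elim(1) by linarith
    hence T: "T \<le> k" by simp
    have "real T * L * W \<le> 2 * real k powr (1/16) * (2 * real k powr (3/4)) * (2 * real k powr (17/16))"
      using bounds by (intro mult_mono) auto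
    also have "\<dots> \<le> 4 * real k ^ 2" by (rule elim(2))
    finally have "real (T * L * W) \<le> real (4 * k\<^sup>2)" by simp
    hence TLW: "T * L * W \<le> 4 * k\<^sup>2" by (simp only: of_nat_le_iff)
    have "(1 - 1 / (2 * real k)) ^ W \<le> exp (- 1 / (2 * real k)) ^ W"
      using exp_ge_add_one_self[of "- 1 / (2 * real k)"] elim(3) by (intro power_mono) auto
    also have "\<dots> = exp (- (W / k) / 2)" by (simp flip: exp_of_nat_mult)
    also have "\<dots> \<le> exp (- (real k powr (1/16)) / 2)"
    proof -
      have "real k powr (1/16) * k = real k powr (17/16)"
        using elim(3) powr_add[of "real k" "1/16" 1] by simp
      hence "real k powr (1/16) \<le> W / k" using bounds(5) elim(3) by (simp add: field_simps)
      thus ?thesis by simp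
    qed
    finally have "real ((n + 1) * (2 * k)) * (1 - 1 / (2 * real k)) ^ W
        \<le> real ((n + 1) * (2 * k)) * exp (- (real k powr (1/16)) / 2)"
      by (intro mult_left_mono) auto
    also have "\<dots> = ?a k" by (simp add: n_def algebra_simps)
    finally have a: "real ((n + 1) * (2 * k)) * (1 - 1 / (2 * real k)) ^ W \<le> ?a k" .
    have "(exp 1 * (10 * real k)) ^ (2 * k) = exp (2 * real k * ln (exp 1 * (10 * real k)))"
      using elim(3) by (simp add: exp_of_nat_mult[of "2 * k", simplified])
    hence "fact k * ((exp 1 * (10 * real k)) ^ (2 * k) * exp (- 3 * real k * T))
       \<le> exp (real k * ln k) * (exp (2 * real k * ln (exp 1 * (10 * real k))) * exp (- 3 * real k * real k powr (1/16)))"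
      using fact_le_exp[OF elim(3)] bounds(1) elim(3) by (intro mult_mono) auto
    also have "\<dots> = ?b k" by (simp only: exp_add[symmetric]) (simp add: algebra_simps)
    finally have b: "fact k * ((exp 1 * (10 * real k)) ^ (2 * k) * exp (- 3 * real k * T)) \<le> ?b k" .
    let ?U = "{\<sigma>. \<forall>\<pi>\<in>chain_bounded k T L. contains_pattern n \<sigma> k \<pi>}"
    have "measure_pmf.prob (pmf_of_set (Sym n)) (- ?U) \<le> ?a k + ?b k"
      using prob_not_universal[OF elim(3) T TLW] a b unfolding n_def Collect_neg_eq by simp
    moreover have "measure_pmf.prob (pmf_of_set (Sym n)) (- ?U) = 1 - measure_pmf.prob (pmf_of_set (Sym n)) ?U"
      using measure_pmf.prob_compl[of ?U "pmf_of_set (Sym n)"] by (simp add: Compl_eq_Diff_UNIV)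
    ultimately show ?case by (simp add: n_def T_def L_def)
  qed
  show "eventually (\<lambda>k. ?P k \<le> 1) sequentially" by simp
qed simp

theorem theorem1p3:
  shows "\<exists>Q :: nat \<Rightarrow> (nat \<Rightarrow> nat) set.
    (\<forall>k\<ge>1. Q k \<subseteq> Sym k) \<and>
    (\<lambda>k. real (card (Q k)) / fact k) \<longlonglongrightarrow> 1 \<and>
    (\<lambda>k. measure_pmf.prob (pmf_of_set (Sym (20 * k\<^sup>2)))
           {\<sigma>. \<forall>\<pi>\<in>Q k. contains_pattern (20 * k\<^sup>2) \<sigma> k \<pi>}) \<longlonglongrightarrow> 1"
proof (intro exI conjI allI impI)
  show "chain_bounded k (shifts k) (chain_length k) \<subseteq> Sym k" for k
    by (auto simp: chain_bounded_def)
qed (fact card_chain_bounded_asymp prob_universal_asymp)+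

end
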